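(* Let $H$ be a finite-dimensional real Hilbert space, $C\subseteq H$ nonempty, closed and convex, and $F:H\to H$ an operator such that (A1) $S_D\neq\emptyset$; (A2) $F$ is quasimonotone; (A3) $F$ is uniformly continuous on $H$; (A4) whenever $\{x_n\}\subset H$ and $x_n\rightharpoonup x$, one has $\|F(x)\|\le\liminf_{n\to\infty}\|F(x_n)\|$. Assume moreover that $F(z)\neq0$ for every $z\in S\setminus S_D$. Let $\{z_n\}$ be the sequence generated by Algorithm 3.1 (with $\epsilon=0$), and assume $z_n\neq w_n$ for all $n$. Then $\{z_n\}$ converges to a point $z^\ell\in S$.
   Context: $\rightharpoonup$ denotes weak convergence. $P_C$ denotes the metric projection onto $C$. $S$ is the solution set of the variational inequality: $x\in C$ with $\langle F(x),w-x\rangle\ge0$ for all $w\in C$. $S_D$ is the set of $z\in C$ with $\langle F(v),v-z\rangle\ge0$ for all $v\in C$. $F$ is quasimonotone if $\langle F(w),z-w\rangle>0$ implies $\langle F(z),z-w\rangle\ge0$ for all $w,z\in H$. Algorithm 3.1 (with $\epsilon=0$): fix $\mu\in(0,1)$, a sequence $\{\xi_n\}\subset[0,\infty)$ with $\sum_{n}\xi_n<\infty$, $z_1\in H$ and $\lambda_1>0$. For $n=1,2,\dots$: $w_n=P_C(z_n-\lambda_nF(z_n))$; $z_{n+1}=w_n+\lambda_n(F(z_n)-F(w_n))$; $\lambda_{n+1}=\min\{\frac{\mu\|z_n-w_n\|}{\|F(z_n)-F(w_n)\|},\lambda_n+\xi_n\}$ if $F(z_n)\neq F(w_n)$, and $\lambda_{n+1}=\lambda_n+\xi_n$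 otherwise. *)

theory Defs
  imports "HOL-Analysis.Analysis"
begin

definition weak_conv :: "(nat \<Rightarrow> 'a::real_inner) \<Rightarrow> 'a \<Rightarrow> bool" where
  "weak_conv xs x \<longleftrightarrow> (\<forall>y. (\<lambda>n. xs n \<bullet> y) \<longlonglongrightarrow> x \<bullet> y)"

definition VI_sol :: "'a::real_inner set \<Rightarrow> ('a \<Rightarrow> 'a) \<Rightarrow> 'a set" where
  "VI_sol C F = {x \<in> C. \<forall>w\<in>C. F x \<bullet> (w - x) \<ge> 0}"

definition VI_dual_sol :: "'a::real_inner set \<Rightarrow> ('a \<Rightarrow> 'a) \<Rightarrow> 'a set" where
  "VI_dual_sol C F = {z \<in> C. \<forall>v\<in>C. F v \<bullet> (v - z) \<ge> 0}"

definition quasimonotone :: "('a::real_inner \<Rightarrow> 'a) \<Rightarrow> bool" where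
  "quasimonotone F \<longleftrightarrow> (\<forall>w z. F w \<bullet> (z - w) > 0 \<longrightarrow> F z \<bullet> (z - w) \<ge> 0)"

end

theory Submission
  imports Defs
begin

text \<open>Quasimonotonicity on the whole space makes every solution \<open>x\<close> with \<open>F x \<noteq> 0\<close> a dual
  solution, so the nonvanishing hypothesis says that all solutions are dual. Each step decreases
  the distance to a dual solution unless the step size \<open>lam\<close> drops by a fixed factor. Since
  \<open>lam\<close> can grow only by the summable \<open>xi\<close>, the step sizes at such drops have a finite sum, and
  as \<open>F\<close> grows at most linearly the iterates are quasi-Fejer: the distance to every dual solution
  converges and \<open>z n - w n\<close> tends to \<open>0\<close>. Some limit point is a solution: if \<open>lam\<close> has a positive
  limit this is immediate, and otherwise one looks along the indices at which \<open>lam\<close> decreases.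
  That limit point is itself dual, so the whole sequence converges to it.\<close>

section \<open>Linear growth of uniformly continuous maps and perturbed monotone sequences\<close>

text \<open>Cut the segment from \<open>y\<close> to \<open>x\<close> into pieces shorter than
  \<open>d\<close>: \<open>F\<close> changes by at most 1 on each, and their number is affine in the
  length. This replaces a Lipschitz bound.\<close>

lemma uniformly_continuous_imp_affine_bound:
  fixes F :: "'a::real_normed_vector \<Rightarrow> 'b::real_normed_vector"
  assumes "uniformly_continuous_on UNIV F"
  obtains M B where "M \<ge> 0" "B \<ge> 0" "\<And>x y. norm (F x - F y) \<le> M * norm (x - y) + B"
proof -
  obtain d where d: "d > 0" "\<And>x y. dist y x < d \<Longrightarrow> dist (F y) (F x) < 1"
    using assms unfolding uniformly_continuous_on_def by (metis UNIV_I zero_less_one)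
  have "norm (F x - F y) \<le> (1 / d) * norm (x - y) + 2" for x y
  proof -
    \<comment> \<open>\<open>Suc\<close> makes the pieces strictly shorter than \<open>d\<close> and
      covers \<open>x = y\<close>; together with the ceiling it costs at most 2, which becomes
      \<open>B\<close>.\<close>
    define N where "N = Suc (nat \<lceil>norm (x - y) / d\<rceil>)"
    have N_lower: "norm (x - y) / d < real N" and N_upper: "real N \<le> norm (x - y) / d + 2"
      using d(1) ceiling_correct[of "norm (x - y) / d"] by (simp_all add: N_def) linarith
    have N_pos: "real N > 0" by (simp add: N_def)
    define q where "q i = y + (real i / real N) *\<^sub>R (x - y)" for i
    have step: "norm (F (q (Suc i)) - F (q i)) \<le> 1" for i
    proof -
      have "q (Suc i) - q i = (1 / real N) *\<^sub>R (x - y)"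
        by (simp add: q_def scaleR_left_diff_distrib[symmetric] diff_divide_distrib[symmetric])
      moreover have "norm (x - y) / real N < d"
        using N_lower N_pos d(1) by (simp add: field_simps)
      ultimately have "dist (q (Suc i)) (q i) < d"
        by (simp add: dist_norm)
      then show ?thesis
        using d(2) by (fastforce simp: dist_norm)
    qed
    have "norm (F (q i) - F y) \<le> real i" for i
    proof (induction i)
      case 0
      then show ?case by (simp add: q_def)
    next
      case (Suc i)
      have "norm (F (q (Suc i)) - F y) \<le> norm (F (q (Suc i)) - F (q i)) + norm (F (q i) - F y)"
        by (metis add_diff_eq diff_add_cancel norm_triangle_ineq)
      then show ?case
        using Suc step[of i] by simp
    qed
    from this[of N] have "norm (F x - F y) \<le> real N"
      using N_pos by (simp add: q_def)
    then show ?thesis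
      using N_upper by simp
  qed
  then show thesis
    using that[of "1 / d" 2] d(1) by simp
qed

text \<open>Passing to \<open>a n + 1\<close> merges the additive error into the factor
  \<open>1 + c n \<le> exp (c n)\<close>; dividing out the accumulated exponentials leaves the
  decreasing sequence \<open>g\<close>.\<close>

lemma quasi_Fejer_convergent:
  fixes a u c :: "nat \<Rightarrow> real"
  assumes a: "\<And>n. a n \<ge> 0" and u: "\<And>n. u n \<ge> 0" and c: "\<And>n. c n \<ge> 0" "summable c"
    and step: "\<And>n. a (Suc n) + u n \<le> (1 + c n) * a n + c n"
  shows "convergent a" "u \<longlonglongrightarrow> 0"
proof -
  define s where "s n = (\<Sum>k<n. c k)" for n
  define g where "g n = (a n + 1) * exp (- s n)" for n
  have step1: "(a (Suc n) + 1) + u n \<le> (1 + c n) * (a n + 1)" for n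
    using step[of n] by (simp add: algebra_simps)
  have "g (Suc n) \<le> g n" for n
  proof -
    have "a (Suc n) + 1 \<le> (1 + c n) * (a n + 1)"
      using step1[of n] u[of n] by linarith
    also have "\<dots> \<le> exp (c n) * (a n + 1)"
      using a[of n] by (intro mult_right_mono exp_ge_add_one_self) auto
    finally have "g (Suc n) \<le> exp (c n) * (a n + 1) * exp (- s (Suc n))"
      unfolding g_def by (intro mult_right_mono) auto
    also have "\<dots> = (a n + 1) * (exp (c n) * exp (- s (Suc n)))"
      by (simp add: mult_ac)
    also have "exp (c n) * exp (- s (Suc n)) = exp (- s n)"
      by (simp add: exp_add[symmetric] s_def)
    finally show ?thesis by (simp add: g_def)
  qed
  then have dec: "decseq g" by (rule decseq_SucI)
  have "g n \<ge> 0" for n using a[of n] by (simp add: g_def)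
  with dec obtain L where "g \<longlonglongrightarrow> L"
    using decseq_convergent[of g 0] by blast
  moreover have "s \<longlonglongrightarrow> suminf c"
    unfolding s_def by (rule summable_LIMSEQ[OF c(2)])
  ultimately have "(\<lambda>n. g n * exp (s n) - 1) \<longlonglongrightarrow> L * exp (suminf c) - 1"
    by (intro tendsto_intros)
  moreover have "g n * exp (s n) - 1 = a n" for n
    by (simp add: g_def exp_minus field_simps)
  ultimately have lim: "a \<longlonglongrightarrow> L * exp (suminf c) - 1"
    by simp
  then show "convergent a" by (auto simp: convergent_def)
  let ?l = "L * exp (suminf c) - 1"
  \<comment> \<open>This slack in the recursion dominates \<open>u n\<close>.\<close>
  have "(\<lambda>n. (1 + c n) * a n + c n - a (Suc n)) \<longlonglongrightarrow> (1 + 0) * ?l + 0 - ?l"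
    by (intro tendsto_intros lim LIMSEQ_Suc[OF lim] summable_LIMSEQ_zero[OF c(2)])
  then have "(\<lambda>n. (1 + c n) * a n + c n - a (Suc n)) \<longlonglongrightarrow> 0" by simp
  then show "u \<longlonglongrightarrow> 0"
  proof (rule tendsto_sandwich[rotated 3])
    show "\<forall>\<^sub>F n in sequentially. u n \<le> (1 + c n) * a n + c n - a (Suc n)"
      using step by (auto simp: algebra_simps)
  qed (auto simp: u)
qed

lemma VI_sol_imp_dual_sol:
  fixes F :: "'a::real_inner \<Rightarrow> 'a"
  assumes qm: "quasimonotone F" and cont: "continuous_on UNIV F"
    and x: "x \<in> VI_sol C F" and nz: "F x \<noteq> 0"
  shows "x \<in> VI_dual_sol C F"
proof -
  have "F v \<bullet> (v - x) \<ge> 0" if v: "v \<in> C" for v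
  proof -
    \<comment> \<open>Moving \<open>v\<close> slightly in the direction \<open>F x\<close> makes \<open>F x \<bullet> (v - x)\<close> strictly positive;
      this may leave \<open>C\<close>, but quasimonotonicity is assumed on the whole space.\<close>
    define y where "y e = v + e *\<^sub>R F x" for e :: real
    have "F (y e) \<bullet> (y e - x) \<ge> 0" if "e > 0" for e
    proof -
      have "F x \<bullet> (y e - x) = F x \<bullet> (v - x) + e * (F x \<bullet> F x)"
        by (simp add: y_def algebra_simps inner_diff_right inner_add_right)
      also have "\<dots> > 0"
        using x v nz that by (auto simp: VI_sol_def intro!: add_nonneg_pos)
      finally show ?thesis
        using qm by (simp add: quasimonotone_def)
    qed
    then have "\<forall>\<^sub>F e in at_right 0. F (y e) \<bullet> (y e - x) \<ge> 0"
      by (auto simp: eventually_at_right_less intro: eventually_at_rightI[of 0 1])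
    moreover have "((\<lambda>e. F (y e) \<bullet> (y e - x)) \<longlongrightarrow> F (y 0) \<bullet> (y 0 - x)) (at_right 0)"
    proof -
      have y: "(y \<longlongrightarrow> y 0) (at_right 0)"
        unfolding y_def by (intro tendsto_intros)
      have "isCont F (y 0)"
        using cont by (simp add: continuous_on_eq_continuous_at)
      then show ?thesis
        by (intro tendsto_intros y isCont_tendsto_compose[OF _ y])
    qed
    ultimately have "F (y 0) \<bullet> (y 0 - x) \<ge> 0"
      by (intro tendsto_lowerbound) auto
    then show ?thesis by (simp add: y_def)
  qed
  then show ?thesis
    using x by (auto simp: VI_dual_sol_def VI_sol_def)
qed

section \<open>The iteration and its step sizes\<close>

locale tseng_iteration =
  fixes C :: "'a::euclidean_space set" and F :: "'a \<Rightarrow> 'a"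
    and z w :: "nat \<Rightarrow> 'a" and lam xi :: "nat \<Rightarrow> real" and mu :: real
  assumes C_ne: "C \<noteq> {}" and C_closed: "closed C" and C_convex: "convex C"
    and F_unif_cont: "uniformly_continuous_on UNIV F"
    and mu: "0 < mu" "mu < 1"
    and xi_nonneg: "xi n \<ge> 0" and xi_sum: "summable xi"
    and lam_0: "lam 0 > 0"
    and w_eq: "w n = closest_point C (z n - lam n *\<^sub>R F (z n))"
    and z_Suc: "z (Suc n) = w n + lam n *\<^sub>R (F (z n) - F (w n))"
    and lam_Suc: "lam (Suc n) =
        (if F (z n) \<noteq> F (w n)
         then min (mu * norm (z n - w n) / norm (F (z n) - F (w n))) (lam n + xi n)
         else lam n + xi n)"
    and z_ne_w: "z n \<noteq> w n"
begin

lemma F_cont: "continuous_on UNIV F"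
  using F_unif_cont by (rule uniformly_continuous_imp_continuous)

lemma F_tendsto: "(f \<longlongrightarrow> l) G \<Longrightarrow> ((\<lambda>x. F (f x)) \<longlongrightarrow> F l) G"
  using F_cont by (auto simp: continuous_on_eq_continuous_at intro: isCont_tendsto_compose)

lemma w_in_C: "w n \<in> C"
  unfolding w_eq by (rule closest_point_in_set[OF C_closed C_ne])

lemma w_obtuse: "v \<in> C \<Longrightarrow> (z n - lam n *\<^sub>R F (z n) - w n) \<bullet> (v - w n) \<le> 0"
  unfolding w_eq by (rule closest_point_dot[OF C_convex C_closed])

text \<open>The assumption \<open>z n \<noteq> w n\<close> keeps the quotient in the minimum
  positive.\<close>

lemma lam_pos: "lam n > 0"
proof (induction n)
  case (Suc n)
  then show ?case
    using mu xi_nonneg[of n] z_ne_w[of n]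
    by (auto simp: lam_Suc add_pos_nonneg)
qed (rule lam_0)

lemma lam_Suc_le: "lam (Suc n) \<le> lam n + xi n"
  by (simp add: lam_Suc)

lemma lam_Suc_F: "lam (Suc n) * norm (F (z n) - F (w n)) \<le> mu * norm (z n - w n)"
proof (cases "F (z n) = F (w n)")
  case False
  then have "lam (Suc n) \<le> mu * norm (z n - w n) / norm (F (z n) - F (w n))"
    by (simp add: lam_Suc)
  then show ?thesis using False by (simp add: field_simps)
qed (use mu in simp)

text \<open>Since \<open>xi n \<ge> 0\<close>, a strict decrease can only come from the quotient in
  the minimum.\<close>

lemma lam_decrease_F:
  assumes "lam (Suc n) < lam n"
  shows "mu * norm (z n - w n) \<le> lam n * norm (F (z n) - F (w n))"
proof -
  have "F (z n) \<noteq> F (w n)" "mu * norm (z n - w n) / norm (F (z n) - F (w n)) < lam n"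
    using assms xi_nonneg[of n] by (auto simp: lam_Suc min_def split: if_splits)
  then show ?thesis by (simp add: field_simps)
qed

lemma lam_le: "lam n \<le> lam 0 + suminf xi"
proof -
  have "lam n \<le> lam 0 + (\<Sum>k<n. xi k)"
  proof (induction n)
    case (Suc n)
    then show ?case using lam_Suc_le[of n] by simp
  qed simp
  then show ?thesis
    using sum_le_suminf[OF xi_sum, of "{..<n}"] xi_nonneg by fastforce
qed

text \<open>Subtracting the partial sums of \<open>xi\<close> makes the step sizes decreasing and
  bounded below.\<close>

lemma lam_convergent: "convergent lam"
proof -
  define s where "s n = (\<Sum>k<n. xi k)" for n
  have s: "s \<longlonglongrightarrow> suminf xi"
    unfolding s_def by (rule summable_LIMSEQ[OF xi_sum])
  have "decseq (\<lambda>n. lam n - s n)"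
    using lam_Suc_le by (intro decseq_SucI) (simp add: s_def algebra_simps)
  moreover have "lam n - s n \<ge> - suminf xi" for n
    using sum_le_suminf[OF xi_sum, of "{..<n}"] xi_nonneg lam_pos[of n]
    by (fastforce simp: s_def)
  ultimately obtain l where "(\<lambda>n. lam n - s n) \<longlonglongrightarrow> l"
    using decseq_convergent[of "\<lambda>n. lam n - s n" "- suminf xi"] by blast
  from tendsto_add[OF this s] have "lam \<longlonglongrightarrow> l + suminf xi"
    by simp
  then show ?thesis
    by (rule convergentI)
qed

text \<open>A step is a drop if the step size shrinks by more than the fixed factor \<open>rho > mu\<close>;
  only at drops can the distance to a dual solution increase.\<close>

definition rho :: real where "rho = (1 + mu) / 2"

definition drop :: "nat \<Rightarrow> real" where
  "drop n = (if lam (Suc n) < rho * lam n then lam n else 0)"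

lemma rho: "mu < rho" "rho < 1" "0 < rho"
  using mu by (auto simp: rho_def)

lemma drop_nonneg: "drop n \<ge> 0"
  using lam_pos[of n] by (simp add: drop_def)

text \<open>A drop at \<open>n\<close> costs more than \<open>(1 - rho) * lam n\<close>, so the
  drops are dominated by a telescoping series plus \<open>xi\<close>.\<close>

lemma drop_summable: "summable drop"
proof -
  have le: "(1 - rho) * drop n \<le> lam n - lam (Suc n) + xi n" for n
    using lam_Suc_le[of n] xi_nonneg[of n] by (auto simp: drop_def algebra_simps)
  have "(\<lambda>n. lam n - lam (Suc n) + xi n) = (\<lambda>n. - (lam (Suc n) - lam n) + xi n)"
    by simp
  moreover have "summable (\<lambda>n. - (lam (Suc n) - lam n) + xi n)"
    using lam_convergent
    by (intro summable_add summable_minus xi_sum) (auto simp: convergent_def intro: telescope_summable)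
  ultimately have "summable (\<lambda>n. lam n - lam (Suc n) + xi n)" by simp
  then have "summable (\<lambda>n. (1 - rho) * drop n)"
  proof (rule summable_comparison_test')
    show "norm ((1 - rho) * drop n) \<le> lam n - lam (Suc n) + xi n" for n
      using le[of n] drop_nonneg[of n] rho by (simp add: abs_mult)
  qed
  then show ?thesis
    using rho by (simp add: summable_cmult_iff)
qed

section \<open>Distances to a dual solution\<close>

text \<open>Expand the square around \<open>w n\<close>. The projection inequality tested with
  \<open>p\<close> and the dual inequality tested at \<open>w n\<close> control the cross
  terms.\<close>

lemma Fejer_step:
  assumes p: "p \<in> VI_dual_sol C F"
  shows "(norm (z (Suc n) - p))\<^sup>2 \<le> (norm (z n - p))\<^sup>2 - (norm (z n - w n))\<^sup>2
    + (lam n * norm (F (z n) - F (w n)))\<^sup>2"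
proof -
  have pC: "p \<in> C" and dual: "F (w n) \<bullet> (w n - p) \<ge> 0"
    using p w_in_C by (auto simp: VI_dual_sol_def)
  have "lam n * (F (w n) \<bullet> (w n - p)) \<ge> 0"
    using dual lam_pos[of n] by simp
  moreover have "(z n - w n) \<bullet> (w n - p) \<ge> lam n * (F (z n) \<bullet> (w n - p))"
    using w_obtuse[OF pC, of n] by (simp add: algebra_simps inner_diff_left inner_diff_right)
  moreover have "(norm (z (Suc n) - p))\<^sup>2 = (norm (z n - p))\<^sup>2 - (norm (z n - w n))\<^sup>2
      - 2 * ((z n - w n) \<bullet> (w n - p)) + 2 * lam n * (F (z n) \<bullet> (w n - p))
      - 2 * lam n * (F (w n) \<bullet> (w n - p)) + (lam n * norm (F (z n) - F (w n)))\<^sup>2"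
    unfolding z_Suc power_mult_distrib power2_norm_eq_inner
    by (simp add: algebra_simps inner_diff_left inner_diff_right inner_add_left inner_add_right
        inner_commute power2_eq_square)
  ultimately show ?thesis by linarith
qed

text \<open>The projection is nonexpansive and fixes \<open>p\<close>, the step sizes are bounded
  and \<open>F\<close> grows affinely, so everything is controlled by the distance to
  \<open>p\<close>. This prices the error made at a drop.\<close>

lemma F_diff_bound:
  assumes p: "p \<in> C"
  obtains A where "A \<ge> 0" "\<And>n. (norm (F (z n) - F (w n)))\<^sup>2 \<le> A * (1 + (norm (z n - p))\<^sup>2)"
proof -
  obtain M B where MB: "M \<ge> 0" "B \<ge> 0"
    and F: "\<And>x y. norm (F x - F y) \<le> M * norm (x - y) + B"
    using uniformly_continuous_imp_affine_bound[OF F_unif_cont] by blast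
  define T where "T = lam 0 + suminf xi"
  have T: "T \<ge> 0" "lam n \<le> T" for n
    using lam_le lam_pos[of 0] lam_le[of 0] by (auto simp: T_def)
  define a where "a = M * T * (norm (F p) + B) + B"
  define b where "b = M * (2 + T * M)"
  have ab: "norm (F (z n) - F (w n)) \<le> a + b * norm (z n - p)" for n
  proof -
    have "norm (w n - p) \<le> norm (z n - lam n *\<^sub>R F (z n) - p)"
      using closest_point_lipschitz[OF C_convex C_closed C_ne, of "z n - lam n *\<^sub>R F (z n)" p] p
      by (simp add: w_eq closest_point_self dist_norm)
    also have "\<dots> \<le> norm (z n - p) + lam n * norm (F (z n))"
      using norm_triangle_ineq4[of "z n - p" "lam n *\<^sub>R F (z n)"] lam_pos[of n]
      by (simp add: algebra_simps)
    also have "lam n * norm (F (z n)) \<le> T * (norm (F p) + (M * norm (z n - p) + B))"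
    proof (intro mult_mono)
      show "norm (F (z n)) \<le> norm (F p) + (M * norm (z n - p) + B)"
        using F[of "z n" p] norm_triangle_sub[of "F (z n)" "F p"] by linarith
    qed (use T in auto)
    finally have w: "norm (w n - p) \<le> norm (z n - p) + T * (norm (F p) + (M * norm (z n - p) + B))"
      by simp
    have "norm (z n - w n) \<le> norm (z n - p) + norm (w n - p)"
      using norm_triangle_ineq4[of "z n - p" "w n - p"] by simp
    with w have "norm (z n - w n) \<le> 2 * norm (z n - p) + T * (norm (F p) + (M * norm (z n - p) + B))"
      by linarith
    then have "M * norm (z n - w n)
        \<le> M * (2 * norm (z n - p) + T * (norm (F p) + (M * norm (z n - p) + B)))"
      using MB(1) by (rule mult_left_mono)
    then show ?thesis
      using F[of "z n" "w n"] by (simp add: a_def b_def algebra_simps)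
  qed
  have "(norm (F (z n) - F (w n)))\<^sup>2 \<le> (2 * (a\<^sup>2 + b\<^sup>2)) * (1 + (norm (z n - p))\<^sup>2)" for n
  proof -
    let ?d = "norm (z n - p)"
    have "(norm (F (z n) - F (w n)))\<^sup>2 \<le> (a + b * ?d)\<^sup>2"
      using ab[of n] by (intro power_mono) auto
    also have "\<dots> \<le> 2 * (a\<^sup>2 + (b * ?d)\<^sup>2)"
      using zero_le_power2[of "a - b * ?d"] by (simp add: power2_eq_square algebra_simps)
    also have "\<dots> \<le> (2 * (a\<^sup>2 + b\<^sup>2)) * (1 + ?d\<^sup>2)"
      by (simp add: algebra_simps power_mult_distrib)
    finally show ?thesis .
  qed
  then show thesis
    using that[of "2 * (a\<^sup>2 + b\<^sup>2)"] by simp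
qed

lemma quasi_Fejer:
  assumes p: "p \<in> VI_dual_sol C F"
  shows "convergent (\<lambda>n. (norm (z n - p))\<^sup>2)" "(\<lambda>n. z n - w n) \<longlonglongrightarrow> 0"
proof -
  obtain A where A: "A \<ge> 0"
    and F: "\<And>n. (norm (F (z n) - F (w n)))\<^sup>2 \<le> A * (1 + (norm (z n - p))\<^sup>2)"
    using F_diff_bound p by (auto simp: VI_dual_sol_def)
  define T where "T = lam 0 + suminf xi"
  have T: "lam n \<le> T" "T \<ge> 0" for n
    using lam_le lam_pos[of 0] lam_le[of 0] by (auto simp: T_def)
  \<comment> \<open>\<open>k\<close> is the share of the squared residual left over when there is no
    drop; at a drop the error goes into \<open>c n\<close> instead.\<close>
  define k where "k = 1 - (mu / rho)\<^sup>2"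
  have k: "k > 0" "k \<le> 1"
    using rho mu by (auto simp: k_def power_less_one_iff)
  define c where "c n = T * A * drop n" for n
  let ?a = "\<lambda>n. (norm (z n - p))\<^sup>2" and ?u = "\<lambda>n. k * (norm (z n - w n))\<^sup>2"
  have step: "?a (Suc n) + ?u n \<le> (1 + c n) * ?a n + c n" for n
  proof (cases "lam (Suc n) < rho * lam n")
    case True
    have "(lam n * norm (F (z n) - F (w n)))\<^sup>2 = lam n * (lam n * (norm (F (z n) - F (w n)))\<^sup>2)"
      by (simp add: power2_eq_square)
    \<comment> \<open>Only one factor \<open>lam n\<close> is bounded by \<open>T\<close>; the other
      stays, because at a drop it equals the summable \<open>drop n\<close>.\<close>
    also have "\<dots> \<le> T * (lam n * (A * (1 + ?a n)))"
      using T F lam_pos[of n] A by (intro mult_mono) auto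
    also have "\<dots> = c n * (1 + ?a n)"
      using True by (simp add: c_def drop_def)
    finally have "(lam n * norm (F (z n) - F (w n)))\<^sup>2 \<le> c n * (1 + ?a n)" .
    moreover have "?u n \<le> (norm (z n - w n))\<^sup>2"
      using k by (simp add: mult_left_le_one_le)
    ultimately show ?thesis
      using Fejer_step[OF p, of n] by (simp add: algebra_simps)
  next
    case False
    then have "rho * (lam n * norm (F (z n) - F (w n))) \<le> lam (Suc n) * norm (F (z n) - F (w n))"
      by (simp add: mult.assoc[symmetric] mult_right_mono)
    \<comment> \<open>Without a drop, replacing \<open>lam (Suc n)\<close> by \<open>lam n\<close>
      costs a factor \<open>1 / rho\<close>, and \<open>mu / rho < 1\<close> still holds.\<close>
    with lam_Suc_F[of n] have "lam n * norm (F (z n) - F (w n)) \<le> mu / rho * norm (z n - w n)"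
      using rho by (simp add: field_simps)
    then have "(lam n * norm (F (z n) - F (w n)))\<^sup>2 \<le> (mu / rho * norm (z n - w n))\<^sup>2"
      using lam_pos[of n] by (intro power_mono) auto
    also have "\<dots> = (mu / rho)\<^sup>2 * (norm (z n - w n))\<^sup>2"
      by (rule power_mult_distrib)
    finally show ?thesis
      using Fejer_step[OF p, of n] False
      by (simp add: c_def drop_def k_def left_diff_distrib)
  qed
  have c: "c n \<ge> 0" "summable c" for n
    unfolding c_def using T A drop_nonneg drop_summable by (auto intro: summable_mult)
  have u: "?u n \<ge> 0" for n using k by simp
  note conv = quasi_Fejer_convergent[where a = ?a and u = ?u, OF _ u c step]
  show "convergent ?a" by (rule conv) simp
  have "?u \<longlonglongrightarrow> 0" by (rule conv) simp
  from tendsto_mult[OF tendsto_const[of "1 / k"] this]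
  have "(\<lambda>n. (norm (z n - w n))\<^sup>2) \<longlonglongrightarrow> 0" using k by simp
  then have "(\<lambda>n. norm (z n - w n)) \<longlonglongrightarrow> 0" by simp
  then show "(\<lambda>n. z n - w n) \<longlonglongrightarrow> 0" by (rule tendsto_norm_zero_cancel)
qed

lemma z_bounded:
  assumes p: "p \<in> VI_dual_sol C F"
  shows "bounded (range z)"
proof -
  obtain L where "(\<lambda>n. (norm (z n - p))\<^sup>2) \<longlonglongrightarrow> L"
    using quasi_Fejer(1)[OF p] by (auto simp: convergent_def)
  from tendsto_real_sqrt[OF this] have "convergent (\<lambda>n. norm (z n - p))"
    by (auto simp: convergent_def)
  then obtain K where "\<And>n. norm (norm (z n - p)) \<le> K"
    by (meson Bseq_def convergent_imp_Bseq)
  then show ?thesis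
    by (intro bounded_subset[OF bounded_cball[of p K]]) (auto simp: dist_norm norm_minus_commute)
qed

section \<open>Limit points and convergence\<close>

text \<open>Divide the projection inequality by \<open>lam (r n)\<close> and pass to the limit. The
  residual is scaled because the step sizes may tend to 0.\<close>

lemma limit_point_VI_sol:
  assumes zr: "(\<lambda>n. z (r n)) \<longlonglongrightarrow> x"
    and wr: "(\<lambda>n. w (r n)) \<longlonglongrightarrow> x"
    and res: "(\<lambda>n. (z (r n) - w (r n)) /\<^sub>R lam (r n)) \<longlonglongrightarrow> 0"
  shows "x \<in> VI_sol C F"
proof -
  have "x \<in> C"
    using closed_sequentially[OF C_closed _ wr] w_in_C by blast
  moreover have "F x \<bullet> (v - x) \<ge> 0" if v: "v \<in> C" for v
  proof -
    have le: "((z (r n) - w (r n)) /\<^sub>R lam (r n)) \<bullet> (v - w (r n)) \<le> F (z (r n)) \<bullet> (v - w (r n))" for n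
    proof -
      have "(z (r n) - w (r n)) \<bullet> (v - w (r n)) \<le> lam (r n) * (F (z (r n)) \<bullet> (v - w (r n)))"
        using w_obtuse[OF v, of "r n"] by (simp add: inner_diff_left algebra_simps)
      then show ?thesis
        using lam_pos[of "r n"] by (simp add: inverse_eq_divide pos_divide_le_eq mult.commute)
    qed
    have "(\<lambda>n. ((z (r n) - w (r n)) /\<^sub>R lam (r n)) \<bullet> (v - w (r n))) \<longlonglongrightarrow> 0 \<bullet> (v - x)"
      by (intro tendsto_intros res wr)
    moreover have "(\<lambda>n. F (z (r n)) \<bullet> (v - w (r n))) \<longlonglongrightarrow> F x \<bullet> (v - x)"
      by (intro tendsto_intros F_tendsto zr wr)
    ultimately show ?thesis
      using le by (intro LIMSEQ_le[of _ 0]) auto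
  qed
  ultimately show ?thesis by (simp add: VI_sol_def)
qed

text \<open>Otherwise the positive step sizes would eventually be nondecreasing and stay away from
  0.\<close>

lemma frequently_lam_decrease:
  assumes "lam \<longlonglongrightarrow> 0"
  shows "infinite {n. lam (Suc n) < lam n}"
proof
  assume "finite {n. lam (Suc n) < lam n}"
  then obtain N where N: "\<And>n. n \<ge> N \<Longrightarrow> lam n \<le> lam (Suc n)"
    by (metis (mono_tags, lifting) finite_nat_set_iff_bounded leD mem_Collect_eq not_le_imp_less)
  have "lam N \<le> lam n" if "n \<ge> N" for n
    using that N by (induction rule: dec_induct) (auto intro: order_trans)
  then have "lam N \<le> 0"
    using assms by (intro LIMSEQ_le_const) auto
  then show False using lam_pos[of N] by simp
qed

lemma limit_point_exists:
  assumes p: "p \<in> VI_dual_sol C F"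
  obtains r x where "strict_mono r" "(\<lambda>n. z (r n)) \<longlonglongrightarrow> x" "x \<in> VI_sol C F"
proof -
  note zw = quasi_Fejer(2)[OF p]
  \<comment> \<open>If the step sizes tend to \<open>0\<close> they decrease infinitely often, and at those indices the
    step-size rule bounds the scaled residual by \<open>norm (F (z n) - F (w n)) / mu\<close>.\<close>
  have "\<exists>r. strict_mono r \<and> (\<lambda>n. (z (r n) - w (r n)) /\<^sub>R lam (r n)) \<longlonglongrightarrow> 0"
  proof -
    obtain l where l: "lam \<longlonglongrightarrow> l" using lam_convergent by (auto simp: convergent_def)
    show ?thesis
    proof (cases "l = 0")
      case False
      have "(\<lambda>n. (z n - w n) /\<^sub>R lam n) \<longlonglongrightarrow> 0 /\<^sub>R l"
        by (intro tendsto_intros zw l False)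
      then show ?thesis
        by (intro exI[of _ id]) (simp add: strict_mono_def)
    next
      case True
      then obtain r :: "nat \<Rightarrow> nat"
        where r: "strict_mono r" "\<And>n. lam (Suc (r n)) < lam (r n)"
        using frequently_lam_decrease l infinite_enumerate[of "{n. lam (Suc n) < lam n}"] by blast
      \<comment> \<open>Uniform continuity gives this although \<open>z n\<close> is not yet known
        to converge.\<close>
      have "(\<lambda>n. F (z n) - F (w n)) \<longlonglongrightarrow> 0"
        using F_unif_cont zw by (simp add: uniformly_continuous_on_sequentially dist_norm tendsto_norm_zero_iff)
      then have "(\<lambda>n. norm (F (z n) - F (w n)) / mu) \<longlonglongrightarrow> 0"
        by (auto intro: tendsto_divide_zero tendsto_norm_zero)
      from LIMSEQ_subseq_LIMSEQ[OF this r(1)]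
      have lim: "(\<lambda>n. norm (F (z (r n)) - F (w (r n))) / mu) \<longlonglongrightarrow> 0"
        by (simp add: o_def)
      have "norm ((z (r n) - w (r n)) /\<^sub>R lam (r n)) \<le> norm (F (z (r n)) - F (w (r n))) / mu" for n
        using lam_decrease_F[OF r(2)[of n]] mu lam_pos[of "r n"]
        by (simp add: inverse_eq_divide pos_divide_le_eq pos_le_divide_eq mult_ac)
      then have "(\<lambda>n. (z (r n) - w (r n)) /\<^sub>R lam (r n)) \<longlonglongrightarrow> 0"
        by (intro Lim_null_comparison[OF _ lim]) auto
      with r(1) show ?thesis by blast
    qed
  qed
  then obtain r where r: "strict_mono r"
    and res: "(\<lambda>n. (z (r n) - w (r n)) /\<^sub>R lam (r n)) \<longlonglongrightarrow> 0" by blast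
  \<comment> \<open>Compactness is applied inside \<open>r\<close>, so the scaled residual still
    vanishes along \<open>r \<circ> s\<close>.\<close>
  have "bounded (range (z \<circ> r))"
    using z_bounded[OF p] by (rule bounded_subset) auto
  then obtain x s where s: "strict_mono s" and "((z \<circ> r) \<circ> s) \<longlonglongrightarrow> x"
    using bounded_imp_convergent_subsequence by blast
  then have rs: "strict_mono (r \<circ> s)" and zx: "(\<lambda>n. z ((r \<circ> s) n)) \<longlonglongrightarrow> x"
    using r by (auto simp: strict_mono_o) (simp add: o_def)
  have "(\<lambda>n. z ((r \<circ> s) n) - (z ((r \<circ> s) n) - w ((r \<circ> s) n))) \<longlonglongrightarrow> x - 0"
    using LIMSEQ_subseq_LIMSEQ[OF zw rs] by (intro tendsto_diff zx) (simp add: o_def)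
  then have "(\<lambda>n. w ((r \<circ> s) n)) \<longlonglongrightarrow> x" by simp
  moreover have "(\<lambda>n. (z ((r \<circ> s) n) - w ((r \<circ> s) n)) /\<^sub>R lam ((r \<circ> s) n)) \<longlonglongrightarrow> 0"
    using LIMSEQ_subseq_LIMSEQ[OF res s] by (simp add: o_def)
  ultimately have "x \<in> VI_sol C F"
    by (rule limit_point_VI_sol[OF zx])
  with that rs zx show thesis by blast
qed

text \<open>The limit point is itself dual, so the distances to it converge along the whole
  sequence, and a subsequence forces their limit to be 0.\<close>

lemma converges_of_sol_subset:
  assumes "VI_dual_sol C F \<noteq> {}" and sub: "VI_sol C F \<subseteq> VI_dual_sol C F"
  obtains x where "x \<in> VI_sol C F" "z \<longlonglongrightarrow> x"
proof -
  obtain r x where r: "strict_mono r" and zx: "(\<lambda>n. z (r n)) \<longlonglongrightarrow> x" and x: "x \<in> VI_sol C F"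
    using assms(1) limit_point_exists by blast
  obtain l where l: "(\<lambda>n. (norm (z n - x))\<^sup>2) \<longlonglongrightarrow> l"
    using quasi_Fejer(1) x sub by (auto simp: convergent_def)
  have "(\<lambda>n. (norm (z (r n) - x))\<^sup>2) \<longlonglongrightarrow> (norm (x - x))\<^sup>2"
    by (intro tendsto_intros zx)
  then have "l = (norm (x - x))\<^sup>2"
    using LIMSEQ_subseq_LIMSEQ[OF l r] unfolding o_def by (rule LIMSEQ_unique[rotated])
  with l have "z \<longlonglongrightarrow> x"
    by (simp add: LIM_zero_iff tendsto_norm_zero_iff)
  with x that show thesis by blast
qed

end

theorem theorem4p1:
  fixes C :: "'a::euclidean_space set" and F :: "'a \<Rightarrow> 'a"
    and z w :: "nat \<Rightarrow> 'a" and lam xi :: "nat \<Rightarrow> real" and mu :: real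
  assumes C_ne: "C \<noteq> {}" and C_closed: "closed C" and C_convex: "convex C"
    and A1: "VI_dual_sol C F \<noteq> {}"
    and A2: "quasimonotone F"
    and A3: "uniformly_continuous_on UNIV F"
    and A4: "\<And>xs x. weak_conv xs x \<Longrightarrow>
               ereal (norm (F x)) \<le> liminf (\<lambda>n. ereal (norm (F (xs n))))"
    and Fnz: "\<And>x. x \<in> VI_sol C F - VI_dual_sol C F \<Longrightarrow> F x \<noteq> 0"
    and mu: "0 < mu" "mu < 1"
    and xi_nonneg: "\<And>n. xi n \<ge> 0" and xi_sum: "summable xi"
    and lam1: "lam 1 > 0"
    and w_def: "\<And>n. n \<ge> 1 \<Longrightarrow> w n = closest_point C (z n - lam n *\<^sub>R F (z n))"
    and z_def: "\<And>n. n \<ge> 1 \<Longrightarrow> z (Suc n) = w n + lam n *\<^sub>R (F (z n) - F (w n))"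
    and lam_def: "\<And>n. n \<ge> 1 \<Longrightarrow> lam (Suc n) =
        (if F (z n) \<noteq> F (w n)
         then min (mu * norm (z n - w n) / norm (F (z n) - F (w n))) (lam n + xi n)
         else lam n + xi n)"
    and z_ne_w: "\<And>n. n \<ge> 1 \<Longrightarrow> z n \<noteq> w n"
  shows "\<exists>zl \<in> VI_sol C F. (\<lambda>n. z n) \<longlonglongrightarrow> zl"
proof -
  \<comment> \<open>The algorithm starts at index 1 and the locale at index 0, hence the
    shift.\<close>
  interpret tseng_iteration C F "\<lambda>n. z (Suc n)" "\<lambda>n. w (Suc n)" "\<lambda>n. lam (Suc n)"
    "\<lambda>n. xi (Suc n)" mu
  proof
    show "summable (\<lambda>n. xi (Suc n))"
      using xi_sum by (simp add: summable_Suc_iff)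
    show "lam (Suc 0) > 0"
      using lam1 by simp
  qed (fact C_ne C_closed C_convex A3 mu xi_nonneg | rule w_def z_def lam_def z_ne_w, simp)+
  \<comment> \<open>By \<open>Fnz\<close>, a solution outside the dual set would have
    \<open>F x \<noteq> 0\<close> and hence be dual after all.\<close>
  have "VI_sol C F \<subseteq> VI_dual_sol C F"
    using VI_sol_imp_dual_sol[OF A2 F_cont] Fnz by blast
  then obtain x where "x \<in> VI_sol C F" "(\<lambda>n. z (Suc n)) \<longlonglongrightarrow> x"
    using converges_of_sol_subset A1 by blast
  then show ?thesis
    using LIMSEQ_imp_Suc by blast
qed

end
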